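(* Let $\alpha\in(0,1/2)$ be irrational. Then $\alpha=1/\varphi^2$, where $\varphi=(1+\sqrt5)/2$ is the golden ratio, if and only if the minimum abelian period of every nonempty factor of slope $\alpha$ belongs to $\{q_k: k\ge0\}$, the set of denominators of the convergents of $\alpha$.
   Context: Write $\alpha=[0;a_1,a_2,\ldots]$ with positive integers $a_i$; $q_0=1$, $q_1=a_1$, $q_k=a_kq_{k-1}+q_{k-2}$ for $k\ge2$ (with $q_{-1}=0$, which is not included in the set). Sturmian words: identify the circle $\mathbb{T}$ with $[0,1)$, let $R(\rho)=\{\rho+\alpha\}$, and fix one of the conventions $I_0=[0,1-\alpha)$, $I_1=[1-\alpha,1)$ or $I_0=(0,1-\alpha]$, $I_1=(1-\alpha,1]$. For $\rho\in\mathbb{T}$ the Sturmian word $\mathbf{s}_{\rho,\alpha}$ has $n$-th letter $0$ if $R^n(\rho)\in I_0$ and $1$ otherwise. All these words (all $\rho$, both conventions) have the same set $\mathcal{L}_\alpha$ of finite factors; its elements are the factors of slope $\alpha$. Abelian periods: the Parikh vector of a binary word $u$ is $(|u|_0,|u|_1)$; $P$ is contained in $Q$ if $P\le Q$ componentwise and $P\ne Q$. An abelian decomposition of $w$ is $w=u_0u_1\cdots u_{n-1}u_n$, $n\ge2$, with $u_1,\dots,u_{n-1}$ having a common Parikh vector $P$ and the Parikh vectors of $u_0,u_n$ contained in $P$; the common length of $u_1,\ldots,u_{n-1}$ is an abelian period of $w$; the minimum abelian period is the least one. *)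

theory Defs
  imports Complex_Main
begin

fun cf_rem :: "real \<Rightarrow> nat \<Rightarrow> real" where
  "cf_rem \<alpha> 0 = \<alpha>"
| "cf_rem \<alpha> (Suc k) = frac (1 / cf_rem \<alpha> k)"

text \<open>Partial quotients a_k for k >= 1: a_k = floor (1 / cf_rem alpha (k-1)).\<close>
definition cf_a :: "real \<Rightarrow> nat \<Rightarrow> nat" where
  "cf_a \<alpha> k = nat \<lfloor>1 / cf_rem \<alpha> (k - 1)\<rfloor>"

fun cf_q :: "real \<Rightarrow> nat \<Rightarrow> nat" where
  "cf_q \<alpha> 0 = 1"
| "cf_q \<alpha> (Suc 0) = cf_a \<alpha> 1"
| "cf_q \<alpha> (Suc (Suc k)) = cf_a \<alpha> (k + 2) * cf_q \<alpha> (Suc k) + cf_q \<alpha> k"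

text \<open>Letter n of the Sturmian word s_{rho,alpha} (letters 0 and 1), with R^n(rho) = frac (rho + n alpha).
  Convention True: I_0 = [0, 1-alpha), I_1 = [1-alpha, 1).
  Convention False: I_0 = (0, 1-alpha], I_1 = (1-alpha, 1] (the point 1 of the circle being 0).\<close>
definition sturmian :: "bool \<Rightarrow> real \<Rightarrow> real \<Rightarrow> nat \<Rightarrow> nat" where
  "sturmian c \<alpha> \<rho> n =
     (let x = frac (\<rho> + real n * \<alpha>) in
      if c then (if x < 1 - \<alpha> then 0 else 1)
      else (if 0 < x \<and> x \<le> 1 - \<alpha> then 0 else 1))"

definition slope_factors :: "real \<Rightarrow> nat list set" where
  "slope_factors \<alpha> = {w. \<exists>c \<rho> i. 0 \<le> \<rho> \<and> \<rho> < 1 \<and>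
       w = map (sturmian c \<alpha> \<rho>) [i..<i + length w]}"

definition parikh :: "nat list \<Rightarrow> nat \<times> nat" where
  "parikh u = (count_list u 0, count_list u 1)"

definition parikh_contained :: "nat \<times> nat \<Rightarrow> nat \<times> nat \<Rightarrow> bool" where
  "parikh_contained P Q \<longleftrightarrow> fst P \<le> fst Q \<and> snd P \<le> snd Q \<and> P \<noteq> Q"

text \<open>An abelian decomposition w = u_0 u_1 ... u_n (n >= 2) is a list us of length n+1 >= 3.\<close>
definition abelian_decomposition :: "nat list \<Rightarrow> nat list list \<Rightarrow> bool" where
  "abelian_decomposition w us \<longleftrightarrow> length us \<ge> 3 \<and> concat us = w \<and>
     (\<exists>P. (\<forall>i. 1 \<le> i \<and> i < length us - 1 \<longrightarrow> parikh (us ! i) = P) \<and>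
          parikh_contained (parikh (us ! 0)) P \<and>
          parikh_contained (parikh (us ! (length us - 1))) P)"

definition abelian_period :: "nat list \<Rightarrow> nat \<Rightarrow> bool" where
  "abelian_period w p \<longleftrightarrow> (\<exists>us. abelian_decomposition w us \<and> p = length (us ! 1))"

definition min_abelian_period :: "nat list \<Rightarrow> nat" where
  "min_abelian_period w = (LEAST p. abelian_period w p)"

end

theory Submission
  imports Defs
begin

text \<open>
  A factor of slope \<open>\<alpha>\<close> is read off from \<open>j \<mapsto> \<lfloor>x + j\<alpha>\<rfloor>\<close>. If \<open>e\<close> consecutive blocks of length
  \<open>m\<close> contain \<open>c\<close> ones each, then \<open>e \<bar>m\<alpha> - c\<bar> < 1\<close>, so a factor of length \<open>n\<close> with abelian period
  \<open>m\<close> satisfies \<open>n + 2 \<le> (e + 2) m\<close> for some \<open>e < 1 / \<parallel>m\<alpha>\<parallel>\<close>. Conversely, if \<open>\<bar>q\<alpha> - p\<bar> \<le> \<alpha>\<close>, the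
  heads and tails of a decomposition into blocks of length \<open>q\<close> are automatically contained in
  \<open>(q - p, p)\<close>, so only the complete blocks matter.

  Write \<open>\<delta>\<^sub>k = \<parallel>q\<^sub>k\<alpha>\<parallel>\<close>. If a partial quotient \<open>a\<^sub>k\<^sub>+\<^sub>1\<close> with \<open>k \<ge> 1\<close> is at least 2, then
  \<open>2\<delta>\<^sub>k \<le> \<alpha>\<close>, and the longest factors with abelian period \<open>2q\<^sub>k < q\<^sub>k\<^sub>+\<^sub>1\<close> are too long to have any of
  the abelian periods \<open>q\<^sub>0, \<dots>, q\<^sub>k\<close>. If \<open>a\<^sub>1 \<ge> 3\<close>, the factor 01 has minimum abelian period 2.
  For the golden slope, \<open>q\<^sub>k < m < q\<^sub>k\<^sub>+\<^sub>1\<close> forces \<open>\<parallel>m\<alpha>\<parallel> \<ge> 2\<delta>\<^sub>k\<^sub>-\<^sub>1\<close>, so a factor with abelian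
  period \<open>m\<close> is short enough to have abelian period \<open>q\<^sub>k\<close> as well.
\<close>

section \<open>Words of slope alpha\<close>

text \<open>The lower mechanical word with intercept \<open>x\<close>. Any real intercept is
  allowed, so shifts and small perturbations need no reduction modulo 1.\<close>

definition slope_word :: "real \<Rightarrow> real \<Rightarrow> nat \<Rightarrow> nat list" where
  "slope_word \<alpha> x n = map (\<lambda>j. nat (\<lfloor>x + real (Suc j) * \<alpha>\<rfloor> - \<lfloor>x + real j * \<alpha>\<rfloor>)) [0..<n]"

lemma length_slope_word [simp]: "length (slope_word \<alpha> x n) = n"
  by (simp add: slope_word_def)

lemma sturmian_lower:
  assumes "0 < \<alpha>" "\<alpha> < 1"
  shows "sturmian True \<alpha> \<rho> n = nat (\<lfloor>\<rho> + real (Suc n) * \<alpha>\<rfloor> - \<lfloor>\<rho> + real n * \<alpha>\<rfloor>)"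
proof -
  define y where "y = \<rho> + real n * \<alpha>"
  have eq: "\<rho> + real (Suc n) * \<alpha> = of_int \<lfloor>y\<rfloor> + (frac y + \<alpha>)"
    by (simp add: y_def frac_def algebra_simps)
  have y01: "0 \<le> frac y" "frac y < 1" by (auto simp: frac_lt_1)
  have "\<lfloor>frac y + \<alpha>\<rfloor> = (if frac y < 1 - \<alpha> then 0 else 1)"
    using y01 assms by (auto simp: floor_eq_iff)
  then have "\<lfloor>\<rho> + real (Suc n) * \<alpha>\<rfloor> - \<lfloor>y\<rfloor> = (if frac y < 1 - \<alpha> then 0 else 1)"
    unfolding eq by simp
  then show ?thesis
    by (simp add: sturmian_def Let_def y_def split: if_splits)
qed

text \<open>With intervals closed on the right, an orbit point at 0 gets the letter 1, which matches
  ceilings in place of floors.\<close>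

lemma sturmian_upper:
  assumes "0 < \<alpha>" "\<alpha> < 1"
  shows "sturmian False \<alpha> \<rho> n = nat (\<lceil>\<rho> + real (Suc n) * \<alpha>\<rceil> - \<lceil>\<rho> + real n * \<alpha>\<rceil>)"
proof -
  define y where "y = \<rho> + real n * \<alpha>"
  obtain K g where y: "y = of_int K + g" "0 \<le> g" "g < 1" "frac y = g"
    by (metis add.commute diff_add_cancel frac_def frac_ge_0 frac_lt_1)
  have "\<rho> + real (Suc n) * \<alpha> = of_int K + (g + \<alpha>)"
    using y(1) by (simp add: y_def algebra_simps)
  then have 1: "\<lceil>\<rho> + real (Suc n) * \<alpha>\<rceil> = K + (if g \<le> 1 - \<alpha> then 1 else 2)"
    using y(2,3) assms by (auto simp: ceiling_eq_iff intro: add_nonneg_pos)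
  have 2: "\<lceil>y\<rceil> = K + (if 0 < g then 1 else 0)"
    using y(1,2,3) by (auto simp: ceiling_eq_iff)
  have "\<lceil>\<rho> + real (Suc n) * \<alpha>\<rceil> - \<lceil>y\<rceil> = (if 0 < g \<and> g \<le> 1 - \<alpha> then 0 else 1)"
    using 1 2 y(2,3) assms by auto
  then show ?thesis
    using y(4) by (auto simp: sturmian_def Let_def y_def)
qed

text \<open>Each \<open>z\<close> exceeds \<open>\<lceil>z\<rceil> - 1\<close> by a positive amount,
  and finitely many such amounts have a positive minimum.\<close>

lemma ceiling_eq_floor_perturbed:
  assumes "finite (A :: real set)"
  shows "\<exists>\<epsilon>>0. \<forall>z\<in>A. \<lfloor>z - \<epsilon>\<rfloor> = \<lceil>z\<rceil> - 1"
proof -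
  define B where "B = insert 1 ((\<lambda>z. z - (of_int \<lceil>z\<rceil> - 1)) ` A)"
  have fin: "finite B" "B \<noteq> {}" using assms by (auto simp: B_def)
  have pos: "b > 0" if "b \<in> B" for b
    using that by (auto simp: B_def) linarith
  have "Min B > 0" using fin pos by simp
  moreover have "\<lfloor>z - Min B\<rfloor> = \<lceil>z\<rceil> - 1" if "z \<in> A" for z
  proof -
    have "Min B \<le> z - (of_int \<lceil>z\<rceil> - 1)"
      using that fin by (intro Min_le) (auto simp: B_def)
    then show ?thesis using \<open>Min B > 0\<close> by (simp add: floor_eq_iff) linarith
  qed
  ultimately show ?thesis by blast
qed

lemma slope_word_shift:
  assumes "w = map (\<lambda>j. nat (\<lfloor>\<rho> + real (Suc j) * \<alpha>\<rfloor> - \<lfloor>\<rho> + real j * \<alpha>\<rfloor>)) [i..<i + n]"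
  shows "w = slope_word \<alpha> (\<rho> + real i * \<alpha>) n"
  unfolding assms slope_word_def
  by (rule nth_equalityI) (auto simp: algebra_simps)

text \<open>A finite factor sees only finitely many orbit points, so in the ceiling convention a
  slight decrease of the intercept yields the same word with floors.\<close>

lemma slope_factorsD:
  assumes "0 < \<alpha>" "\<alpha> < 1" "w \<in> slope_factors \<alpha>"
  shows "\<exists>x. w = slope_word \<alpha> x (length w)"
proof -
  obtain c \<rho> i where w: "w = map (sturmian c \<alpha> \<rho>) [i..<i + length w]"
    using assms by (auto simp: slope_factors_def)
  show ?thesis
  proof (cases c)
    case True
    then have "w = map (\<lambda>j. nat (\<lfloor>\<rho> + real (Suc j) * \<alpha>\<rfloor> - \<lfloor>\<rho> + real j * \<alpha>\<rfloor>)) [i..<i + length w]"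
      using w sturmian_lower[OF assms(1,2)] by (metis (mono_tags, lifting) map_cong)
    then show ?thesis using slope_word_shift by blast
  next
    case False
    obtain \<epsilon> where \<epsilon>: "\<forall>z \<in> (\<lambda>j. \<rho> + real j * \<alpha>) ` {..i + length w}. \<lfloor>z - \<epsilon>\<rfloor> = \<lceil>z\<rceil> - 1"
      using ceiling_eq_floor_perturbed[of "(\<lambda>j. \<rho> + real j * \<alpha>) ` {..i + length w}"] by auto
    have fl: "\<lfloor>\<rho> - \<epsilon> + real j * \<alpha>\<rfloor> = \<lceil>\<rho> + real j * \<alpha>\<rceil> - 1" if "j \<le> i + length w" for j
    proof -
      have "\<rho> - \<epsilon> + real j * \<alpha> = (\<rho> + real j * \<alpha>) - \<epsilon>" by simp
      then show ?thesis using \<epsilon> that by (metis atMost_iff image_eqI)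
    qed
    have "map (sturmian c \<alpha> \<rho>) [i..<i + length w] =
      map (\<lambda>j. nat (\<lfloor>\<rho> - \<epsilon> + real (Suc j) * \<alpha>\<rfloor> - \<lfloor>\<rho> - \<epsilon> + real j * \<alpha>\<rfloor>)) [i..<i + length w]"
    proof (rule map_cong[OF refl])
      fix j assume "j \<in> set [i..<i + length w]"
      then have "Suc j \<le> i + length w" by auto
      then show "sturmian c \<alpha> \<rho> j = nat (\<lfloor>\<rho> - \<epsilon> + real (Suc j) * \<alpha>\<rfloor> - \<lfloor>\<rho> - \<epsilon> + real j * \<alpha>\<rfloor>)"
        using False sturmian_upper[OF assms(1,2), of \<rho> j] fl[of j] fl[of "Suc j"] by simp
    qed
    with w have "w = map (\<lambda>j. nat (\<lfloor>\<rho> - \<epsilon> + real (Suc j) * \<alpha>\<rfloor> - \<lfloor>\<rho> - \<epsilon> + real j * \<alpha>\<rfloor>)) [i..<i + length w]"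
      by simp
    then show ?thesis using slope_word_shift by blast
  qed
qed

lemma slope_word_in_slope_factors:
  assumes "0 < \<alpha>" "\<alpha> < 1"
  shows "slope_word \<alpha> x n \<in> slope_factors \<alpha>"
proof -
  have "\<lfloor>x + real (Suc j) * \<alpha>\<rfloor> - \<lfloor>x + real j * \<alpha>\<rfloor>
      = \<lfloor>frac x + real (Suc j) * \<alpha>\<rfloor> - \<lfloor>frac x + real j * \<alpha>\<rfloor>" for j
  proof -
    have "frac x + y = (x + y) - of_int \<lfloor>x\<rfloor>" for y by (simp add: frac_def)
    then have "\<lfloor>x + y\<rfloor> = \<lfloor>x\<rfloor> + \<lfloor>frac x + y\<rfloor>" for y
      by (simp only: floor_diff_of_int)
    then show ?thesis by simp
  qed
  then have "slope_word \<alpha> x n = map (sturmian True \<alpha> (frac x)) [0..<0 + length (slope_word \<alpha> x n)]"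
    using sturmian_lower[OF assms, of "frac x"] by (simp add: slope_word_def)
  then show ?thesis unfolding slope_factors_def mem_Collect_eq
    by (intro exI[of _ True] exI[of _ "frac x"] exI[of _ 0]) (auto simp: frac_lt_1)
qed

lemma floor_slope_step:
  assumes "0 < \<alpha>" "\<alpha> < 1"
  shows "\<lfloor>x + real (Suc j) * \<alpha>\<rfloor> - \<lfloor>x + real j * \<alpha>\<rfloor> \<in> {0, 1}"
proof -
  have "x + real (Suc j) * \<alpha> = (x + real j * \<alpha>) + \<alpha>" by (simp add: algebra_simps)
  then show ?thesis using assms by simp linarith
qed

text \<open>The letters telescope, so Parikh vectors become increments of a floor function.\<close>

lemma count_slope_letters:
  fixes x :: real
  assumes "0 < \<alpha>" "\<alpha> < 1" "a \<le> b"
  defines "v \<equiv> map (\<lambda>j. nat (\<lfloor>x + real (Suc j) * \<alpha>\<rfloor> - \<lfloor>x + real j * \<alpha>\<rfloor>)) [a..<b]"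
  shows "int (count_list v 1) = \<lfloor>x + real b * \<alpha>\<rfloor> - \<lfloor>x + real a * \<alpha>\<rfloor>"
    and "int (count_list v 0) = int (b - a) - (\<lfloor>x + real b * \<alpha>\<rfloor> - \<lfloor>x + real a * \<alpha>\<rfloor>)"
proof -
  let ?l = "\<lambda>j. nat (\<lfloor>x + real (Suc j) * \<alpha>\<rfloor> - \<lfloor>x + real j * \<alpha>\<rfloor>)"
  have "int (count_list (map ?l [a..<b]) 1) = \<lfloor>x + real b * \<alpha>\<rfloor> - \<lfloor>x + real a * \<alpha>\<rfloor> \<and>
     int (count_list (map ?l [a..<b]) 0) = int (b - a) - (\<lfloor>x + real b * \<alpha>\<rfloor> - \<lfloor>x + real a * \<alpha>\<rfloor>)"
    using \<open>a \<le> b\<close>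
  proof (induction b rule: dec_induct)
    case base then show ?case by simp
  next
    case (step b)
    then show ?case using floor_slope_step[OF assms(1,2), of x b]
      by (auto simp: upt_Suc_append Suc_diff_le)
  qed
  then show "int (count_list v 1) = \<lfloor>x + real b * \<alpha>\<rfloor> - \<lfloor>x + real a * \<alpha>\<rfloor>"
    and "int (count_list v 0) = int (b - a) - (\<lfloor>x + real b * \<alpha>\<rfloor> - \<lfloor>x + real a * \<alpha>\<rfloor>)"
    by (simp_all add: v_def)
qed

section \<open>Abelian periods of words of slope alpha\<close>

lemma set_slope_word:
  assumes "0 < \<alpha>" "\<alpha> < 1"
  shows "set (slope_word \<alpha> x n) \<subseteq> {0, 1}"
proof -
  have "nat (\<lfloor>x + real (Suc j) * \<alpha>\<rfloor> - \<lfloor>x + real j * \<alpha>\<rfloor>) \<in> {0, 1}" for j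
    using floor_slope_step[OF assms, of x j] by auto
  then show ?thesis unfolding slope_word_def set_map by (rule image_subsetI)
qed

lemma count_binary: "set u \<subseteq> {0, 1::nat} \<Longrightarrow> count_list u 0 + count_list u 1 = length u"
  by (induction u) auto

text \<open>Only the total length and total number of ones of the \<open>e\<close> blocks are kept.
  In a binary word the Parikh entries sum to the length, so strict containment makes head and tail
  shorter than \<open>m\<close>.\<close>

lemma abelian_periodD:
  assumes "abelian_period w m" "set w \<subseteq> {0, 1}"
  obtains u v z e c where "w = u @ v @ z" "length u < m" "length z < m" "0 < e"
    "length v = e * m" "count_list v 1 = e * c"
proof -
  obtain us where dec: "abelian_decomposition w us" "m = length (us ! 1)"
    using assms(1) by (auto simp: abelian_period_def)
  then obtain P where us: "length us \<ge> 3" "concat us = w" "m = length (us ! 1)"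
    "\<forall>i. 1 \<le> i \<and> i < length us - 1 \<longrightarrow> parikh (us ! i) = P"
    "parikh_contained (parikh (us ! 0)) P"
    "parikh_contained (parikh (us ! (length us - 1))) P"
    unfolding abelian_decomposition_def by (elim conjE exE) (rule that)
  obtain u rest where ur: "us = u # rest" using us(1) by (cases us) auto
  obtain bs z where bz: "rest = bs @ [z]" using us(1) ur by (cases rest rule: rev_cases) auto
  have us': "us = u # bs @ [z]" using ur bz by simp
  have bs_ne: "bs \<noteq> []" using us(1) us' by auto
  have P: "parikh b = P" if b: "b \<in> set bs" for b
  proof -
    obtain i where "i < length bs" "b = bs ! i" using b by (auto simp: in_set_conv_nth)
    then show ?thesis using us(4)[rule_format, of "Suc i"] us' by (simp add: nth_append)
  qed
  have "set w = set u \<union> (\<Union>b\<in>set bs. set b) \<union> set z" using us(2) us' by auto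
  with assms(2) have bin: "set u \<subseteq> {0,1}" "set z \<subseteq> {0,1}" "\<And>b. b \<in> set bs \<Longrightarrow> set b \<subseteq> {0,1}"
    by blast+
  have len: "length b = fst P + snd P" if "b \<in> set bs" for b
    using count_binary[OF bin(3)[OF that]] P[OF that] by (auto simp: parikh_def)
  have m: "m = fst P + snd P"
  proof -
    have "us ! 1 = hd bs" using us' bs_ne by (simp add: nth_append hd_conv_nth)
    then show ?thesis using len[of "hd bs"] bs_ne us(3) by simp
  qed
  have lu: "length u < m" using us(5) us' m count_binary[OF bin(1)]
    by (cases P) (auto simp: parikh_contained_def parikh_def)
  have lz: "length z < m" using us(6) us' m count_binary[OF bin(2)]
    by (cases P) (auto simp: parikh_contained_def parikh_def nth_append)
  have "\<forall>b\<in>set bs. length b = m \<and> count_list b 1 = snd P"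
    using len P m by (metis parikh_def snd_conv)
  then have "length (concat bs) = length bs * m \<and> count_list (concat bs) 1 = length bs * snd P"
    by (induction bs) auto
  moreover have "w = u @ concat bs @ z" using us(2) us' by simp
  moreover have "0 < length bs" using bs_ne by simp
  ultimately show ?thesis using lu lz that[of u "concat bs" z "length bs" "snd P"] by simp
qed

text \<open>A floor increment over \<open>e * m\<close> letters differs from
  \<open>e * m * \<alpha>\<close> by less than 1. Head and tail have at most \<open>m - 1\<close>
  letters each, whence the \<open>+ 2\<close>.\<close>

lemma abelian_period_slope_wordD:
  assumes "0 < \<alpha>" "\<alpha> < 1" "abelian_period (slope_word \<alpha> x n) m"
  obtains e :: nat and c :: int where "n + 2 \<le> (e + 2) * m" "0 < e" "0 < m" "m \<le> n"
    "real e * \<bar>real m * \<alpha> - of_int c\<bar> < 1"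
proof -
  obtain u v z e c where d: "slope_word \<alpha> x n = u @ v @ z" "length u < m" "length z < m" "0 < e"
    "length v = e * m" "count_list v 1 = e * c"
    by (rule abelian_periodD[OF assms(3) set_slope_word[OF assms(1,2)]])
  define a where "a = length u"
  have n: "n = a + e * m + length z" using arg_cong[OF d(1), of length] d(5) by (simp add: a_def)
  have "v = take (e * m) (drop a (slope_word \<alpha> x n))" using d(1,5) by (simp add: a_def)
  then have v: "v = map (\<lambda>j. nat (\<lfloor>x + real (Suc j) * \<alpha>\<rfloor> - \<lfloor>x + real j * \<alpha>\<rfloor>)) [a..<a + e * m]"
    unfolding slope_word_def by (simp add: take_map drop_map n take_upt)
  have "int (e * c) = \<lfloor>x + real (a + e * m) * \<alpha>\<rfloor> - \<lfloor>x + real a * \<alpha>\<rfloor>"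
    using count_slope_letters(1)[OF assms(1,2), of a "a + e * m" x] d(6) v by simp
  moreover have "x + real (a + e * m) * \<alpha> = (x + real a * \<alpha>) + real (e * m) * \<alpha>"
    by (simp add: algebra_simps)
  ultimately have "\<bar>real (e * m) * \<alpha> - real (e * c)\<bar> < 1"
    by linarith
  moreover have "real (e * m) * \<alpha> - real (e * c) = real e * (real m * \<alpha> - of_int (int c))"
    by (simp add: algebra_simps)
  ultimately have "real e * \<bar>real m * \<alpha> - of_int (int c)\<bar> < 1"
    by (simp add: abs_mult)
  moreover have "n + 2 \<le> (e + 2) * m" using n d(2,3) a_def by (simp add: algebra_simps)
  moreover have "m \<le> n" using n d(4) by (cases e) auto
  moreover have "0 < m" using d(2) by simp
  ultimately show ?thesis using that d(4) by blast
qed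

text \<open>Strictness of the containments comes from head and tail being shorter than
  \<open>m\<close>, so only componentwise bounds are assumed.\<close>

lemma abelian_period_slope_wordI:
  fixes c :: nat
  assumes "0 < \<alpha>" "\<alpha> < 1" and S: "\<And>j. S j = \<lfloor>x + real j * \<alpha>\<rfloor>"
    and "0 < N" "r < m" "r + N * m \<le> n" "n < r + (N + 1) * m"
    and blocks: "\<And>i. i \<le> N \<Longrightarrow> S (r + i * m) = S r + int (i * c)"
    and head: "S r - S 0 \<le> int c" "int r - (S r - S 0) \<le> int m - int c"
    and tail: "S n - S (r + N * m) \<le> int c"
      "int (n - (r + N * m)) - (S n - S (r + N * m)) \<le> int m - int c"
  shows "abelian_period (slope_word \<alpha> x n) m"
proof -
  define f where "f a b = map (\<lambda>j. nat (\<lfloor>x + real (Suc j) * \<alpha>\<rfloor> - \<lfloor>x + real j * \<alpha>\<rfloor>)) [a..<b]" for a b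
  have app: "f a b @ f b b' = f a b'" if "a \<le> b" "b \<le> b'" for a b b'
  proof -
    have "[a..<b'] = [a..<b] @ [b..<b']" using that by (metis le_add_diff_inverse upt_add_eq_append)
    then show ?thesis by (simp add: f_def)
  qed
  have ones: "int (count_list (f a b) 1) = S b - S a"
    and zeros: "int (count_list (f a b) 0) = int (b - a) - (S b - S a)" if "a \<le> b" for a b
    using count_slope_letters[OF assms(1,2) that, of x] by (auto simp: f_def S)
  define bs where "bs = map (\<lambda>i. f (r + i * m) (r + (i + 1) * m)) [0..<N]"
  define us where "us = f 0 r # bs @ [f (r + N * m) n]"
  have cat: "concat (map (\<lambda>i. f (r + i * m) (r + (i + 1) * m)) [0..<M]) = f r (r + M * m)" for M
    by (induction M) (simp_all add: app, simp add: f_def)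
  have w: "concat us = slope_word \<alpha> x n"
    using assms by (simp add: us_def bs_def cat[simplified] app) (simp add: f_def slope_word_def)
  have lbs: "length bs = N" by (simp add: bs_def)
  have blk: "count_list (bs ! i) 1 = c" "count_list (bs ! i) 0 + c = m" if "i < N" for i
  proof -
    have "S (r + (i + 1) * m) - S (r + i * m) = int c"
      using blocks[of i] blocks[of "Suc i"] that by (simp add: algebra_simps)
    then show "count_list (bs ! i) 1 = c" "count_list (bs ! i) 0 + c = m"
      using ones[of "r + i * m" "r + (i + 1) * m"] zeros[of "r + i * m" "r + (i + 1) * m"] that
      by (simp_all add: bs_def)
  qed
  have "c \<le> m" using blk(2)[of 0] \<open>0 < N\<close> by linarith
  have pb: "parikh (bs ! i) = (m - c, c)" if "i < N" for i
    using blk[OF that] by (simp add: parikh_def)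
  have nth: "us ! Suc i = bs ! i" if "i < N" for i
    using that by (simp add: us_def nth_append lbs)
  have "parikh_contained (parikh (us ! 0)) (m - c, c)"
    using ones[of 0 r] zeros[of 0 r] head \<open>r < m\<close> \<open>c \<le> m\<close>
    by (auto simp: parikh_contained_def parikh_def us_def)
  moreover have "parikh_contained (parikh (us ! (length us - 1))) (m - c, c)"
  proof -
    obtain t where t: "n = r + N * m + t" "t < m"
      using assms(6,7) that[of "n - (r + N * m)"] by simp
    have "us ! (length us - 1) = f (r + N * m) n" by (simp add: us_def nth_append)
    then show ?thesis
      using ones[of "r + N * m" n] zeros[of "r + N * m" n] tail \<open>c \<le> m\<close> t
      by (auto simp: parikh_contained_def parikh_def)
  qed
  moreover have "parikh (us ! i) = (m - c, c)" if "1 \<le> i" "i < length us - 1" for i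
    using that pb[of "i - 1"] nth[of "i - 1"] by (simp add: us_def lbs)
  ultimately have "abelian_decomposition (slope_word \<alpha> x n) us"
    unfolding abelian_decomposition_def using w \<open>0 < N\<close>
    by (intro conjI exI[of _ "(m - c, c)"]) (auto simp: us_def lbs)
  moreover have "length (us ! 1) = m"
    using nth[of 0] \<open>0 < N\<close> by (simp add: bs_def f_def)
  ultimately show ?thesis unfolding abelian_period_def by metis
qed

text \<open>A jump by \<open>q\<close> letters moves the orbit by \<open>d\<close> modulo 1. While
  \<open>f + i * d\<close> stays in \<open>[0, 1)\<close>, every block has exactly \<open>p\<close>
  ones; the drift is monotone, so checking \<open>i = N\<close> suffices.\<close>

lemma abelian_period_of_approximation:
  fixes p q :: nat and x :: real
  assumes \<alpha>: "0 < \<alpha>" "\<alpha> < 1 / 2" and d: "d = real q * \<alpha> - real p" "\<bar>d\<bar> \<le> \<alpha>"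
    and N: "0 < N" "r < q" "r + N * q \<le> n" "n < r + (N + 1) * q"
    and f: "f = frac (x + real r * \<alpha>)" "0 \<le> f + real N * d" "f + real N * d < 1"
  shows "abelian_period (slope_word \<alpha> x n) q"
proof -
  define K where "K = \<lfloor>x + real r * \<alpha>\<rfloor>"
  have y: "x + real r * \<alpha> = of_int K + f" by (simp add: K_def f frac_def)
  have f01: "0 \<le> f" "f < 1" by (auto simp: f frac_lt_1)
  define S where "S j = \<lfloor>x + real j * \<alpha>\<rfloor>" for j
  have S_eqI: "S j = k" if "x + real j * \<alpha> = of_int k + g" "0 \<le> g" "g < 1" for j k g
    using that by (simp add: S_def floor_eq_iff)
  have qa: "real q * \<alpha> = real p + d" by (simp add: d)
  have blocks: "S (r + i * q) = K + int (i * p)" if "i \<le> N" for i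
  proof (rule S_eqI)
    have "x + real (r + i * q) * \<alpha> = x + real r * \<alpha> + real i * (real q * \<alpha>)" by (simp add: algebra_simps)
    then show "x + real (r + i * q) * \<alpha> = of_int (K + int (i * p)) + (f + real i * d)"
      unfolding y qa by (simp add: algebra_simps)
    show "0 \<le> f + real i * d"
    proof (cases "0 \<le> d")
      case False
      then have "real N * d \<le> real i * d" using that by (intro mult_right_mono_neg) auto
      then show ?thesis using f by linarith
    qed (use f01 in simp)
    show "f + real i * d < 1"
    proof (cases "0 \<le> d")
      case True
      then have "real i * d \<le> real N * d" using that by (intro mult_right_mono) auto
      then show ?thesis using f by linarith
    next
      case False
      then have "real i * d \<le> 0" by (simp add: mult_nonneg_nonpos)
      then show ?thesis using f01 by linarith
    qed
  qed
  have Sr: "S r = K" using blocks[of 0] by simp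
  \<comment> \<open>The margins for ones and zeros when \<open>s\<close> letters are cut off a
    block. Both are at least \<open>\<bar>d\<bar>\<close>, the second because
    \<open>\<alpha> < 1 / 2\<close>.\<close>
  have bound: "\<alpha> \<le> real s * \<alpha>" "1 - \<alpha> \<le> real s - real s * \<alpha>" if "1 \<le> s" for s
  proof -
    show "\<alpha> \<le> real s * \<alpha>" using that \<alpha> by (simp add: mult_le_cancel_right1)
    have "1 - \<alpha> \<le> real s * (1 - \<alpha>)" using that \<alpha> by (simp add: mult_le_cancel_right1)
    then show "1 - \<alpha> \<le> real s - real s * \<alpha>" by (simp add: algebra_simps)
  qed
  \<comment> \<open>The head is the end of a virtual block starting at position
    \<open>r - q\<close>, with its first \<open>s\<close> letters missing.\<close>
  define s where "s = q - r"
  have s: "1 \<le> s" "q = r + s" using N by (auto simp: s_def)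
  have "x = of_int K - real p + (f - d + real s * \<alpha>)"
    using y qa s(2) by (simp add: algebra_simps)
  moreover have "0 \<le> f - d + real s * \<alpha>" "f - d + real s * \<alpha> < real s + 1"
    using bound[OF s(1)] d(2) f01 \<alpha> by linarith+
  moreover have "S 0 = \<lfloor>x\<rfloor>" by (simp add: S_def)
  ultimately have S0: "K - int p \<le> S 0" "S 0 \<le> K - int p + int s"
    by linarith+
  \<comment> \<open>Likewise the tail is a virtual block with its last \<open>s'\<close> letters
    missing.\<close>
  define t where "t = n - (r + N * q)"
  define s' where "s' = q - t"
  have t: "n = r + N * q + t" "q = t + s'" "1 \<le> s'" using N by (auto simp: t_def s'_def)
  have "x + real n * \<alpha> = x + real r * \<alpha> + real N * (real q * \<alpha>) + (real q * \<alpha> - real s' * \<alpha>)"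
    using t by (simp add: algebra_simps)
  then have "x + real n * \<alpha> = of_int (K + int (N * p)) + real p + (f + real N * d + d - real s' * \<alpha>)"
    unfolding y qa by (simp add: algebra_simps)
  moreover have "f + real N * d + d - real s' * \<alpha> < 1" "- real s' \<le> f + real N * d + d - real s' * \<alpha>"
    using bound[OF t(3)] d(2) f(2,3) \<alpha> by linarith+
  ultimately have Sn: "K + int (N * p) + int p - int s' \<le> S n" "S n \<le> K + int (N * p) + int p"
    unfolding S_def by linarith+
  show ?thesis
  proof (rule abelian_period_slope_wordI[where S = S and N = N and r = r and c = p])
    show "S (r + i * q) = S r + int (i * p)" if "i \<le> N" for i
      using blocks[OF that] Sr by simp
    show "S r - S 0 \<le> int p" "int r - (S r - S 0) \<le> int q - int p"
      using S0 Sr s by auto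
    show "S n - S (r + N * q) \<le> int p"
      "int (n - (r + N * q)) - (S n - S (r + N * q)) \<le> int q - int p"
      using Sn blocks[of N] t by auto
  qed (use \<alpha> N S_def in auto)
qed

text \<open>Guarantees that the \<open>LEAST\<close> in \<open>min_abelian_period\<close> is
  attained.\<close>

lemma abelian_period_length_slope_word:
  assumes "0 < \<alpha>" "\<alpha> < 1" "0 < n"
  shows "abelian_period (slope_word \<alpha> x n) n"
proof -
  let ?w = "slope_word \<alpha> x n"
  have "parikh ?w \<noteq> (0, 0)"
    using count_binary[OF set_slope_word[OF assms(1,2)], of x n] assms(3) by (auto simp: parikh_def)
  then have "parikh_contained (parikh []) (parikh ?w)"
    by (auto simp: parikh_contained_def parikh_def)
  then have "abelian_decomposition ?w [[], ?w, []]"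
    unfolding abelian_decomposition_def
    by (intro conjI exI[of _ "parikh ?w"]) (auto simp: less_Suc_eq numeral_2_eq_2)
  then show ?thesis unfolding abelian_period_def by (intro exI[of _ "[[], ?w, []]"]) simp
qed


section \<open>Convergents\<close>

fun cf_p :: "real \<Rightarrow> nat \<Rightarrow> nat" where
  "cf_p \<alpha> 0 = 0"
| "cf_p \<alpha> (Suc 0) = 1"
| "cf_p \<alpha> (Suc (Suc k)) = cf_a \<alpha> (k + 2) * cf_p \<alpha> (Suc k) + cf_p \<alpha> k"

text \<open>A product of Gauss map iterates; for the slopes considered here it is the distance from
  \<open>cf_q \<alpha> k * \<alpha>\<close> to the nearest integer.\<close>

definition cf_err :: "real \<Rightarrow> nat \<Rightarrow> real" where
  "cf_err \<alpha> k = (\<Prod>i\<le>k. cf_rem \<alpha> i)"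

lemma cf_err_0 [simp]: "cf_err \<alpha> 0 = \<alpha>"
  and cf_err_Suc: "cf_err \<alpha> (Suc k) = cf_err \<alpha> k * cf_rem \<alpha> (Suc k)"
  by (simp_all add: cf_err_def)

text \<open>Unimodularity of consecutive convergents, used to expand any pair \<open>(m, c)\<close>
  in them with integer coefficients.\<close>

lemma cf_p_cf_q_det:
  "int (cf_p \<alpha> (Suc k)) * int (cf_q \<alpha> k) - int (cf_p \<alpha> k) * int (cf_q \<alpha> (Suc k)) = (-1) ^ k"
proof (induction k)
  case (Suc k)
  then show ?case by (simp add: algebra_simps)
qed simp

locale irrational_slope =
  fixes \<alpha> :: real
  assumes irrational: "\<alpha> \<notin> \<rat>" and pos: "0 < \<alpha>" and less_half: "\<alpha> < 1 / 2"
begin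

lemma less_one: "\<alpha> < 1"
  using less_half by simp

lemma cf_rem_irrational: "cf_rem \<alpha> k \<notin> \<rat>"
proof (induction k)
  case (Suc k)
  show ?case
  proof
    assume "cf_rem \<alpha> (Suc k) \<in> \<rat>"
    then have "frac (1 / cf_rem \<alpha> k) + of_int \<lfloor>1 / cf_rem \<alpha> k\<rfloor> \<in> \<rat>" by simp
    then have "1 / cf_rem \<alpha> k \<in> \<rat>" by (simp add: frac_def)
    then have "inverse (1 / cf_rem \<alpha> k) \<in> \<rat>" by (rule Rats_inverse)
    then show False using Suc by simp
  qed
qed (use irrational in simp)

lemma cf_rem_bounds: "0 < cf_rem \<alpha> k" "cf_rem \<alpha> k < 1"
proof -
  have "cf_rem \<alpha> k \<noteq> 0" using cf_rem_irrational[of k] by (metis Rats_0)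
  moreover have "0 \<le> cf_rem \<alpha> k" using pos by (cases k) auto
  ultimately show "0 < cf_rem \<alpha> k" by simp
  show "cf_rem \<alpha> k < 1" using less_one by (cases k) (auto simp: frac_lt_1)
qed

lemma one_div_cf_rem: "1 / cf_rem \<alpha> k = real (cf_a \<alpha> (Suc k)) + cf_rem \<alpha> (Suc k)"
proof -
  have "0 \<le> \<lfloor>1 / cf_rem \<alpha> k\<rfloor>" using cf_rem_bounds[of k] by simp
  then show ?thesis by (simp add: cf_a_def frac_def)
qed

lemma cf_a_pos: "1 \<le> cf_a \<alpha> (Suc k)"
proof -
  have "1 < 1 / cf_rem \<alpha> k" using cf_rem_bounds[of k] by simp
  then show ?thesis using one_div_cf_rem[of k] cf_rem_bounds[of "Suc k"] by linarith
qed

lemma cf_a_1: "2 \<le> cf_a \<alpha> (Suc 0)"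
proof -
  have "2 < 1 / cf_rem \<alpha> 0" using pos less_half by (simp add: field_simps)
  then show ?thesis using one_div_cf_rem[of 0] cf_rem_bounds[of "Suc 0"] by linarith
qed

lemma cf_err_pos: "0 < cf_err \<alpha> k"
  using cf_rem_bounds(1) by (simp add: cf_err_def prod_pos)

lemma cf_err_less: "cf_err \<alpha> (Suc k) < cf_err \<alpha> k"
  using cf_err_pos[of k] cf_rem_bounds[of "Suc k"] by (simp add: cf_err_Suc)

lemma cf_err_antimono: "j \<le> k \<Longrightarrow> cf_err \<alpha> k \<le> cf_err \<alpha> j"
  by (rule lift_Suc_antimono_le[of "cf_err \<alpha>"]) (use cf_err_less less_imp_le in auto)

lemma cf_err_le: "cf_err \<alpha> k \<le> \<alpha>"
  using cf_err_antimono[of 0 k] by simp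

lemma cf_err_rec:
  "cf_err \<alpha> k = real (cf_a \<alpha> (Suc (Suc k))) * cf_err \<alpha> (Suc k) + cf_err \<alpha> (Suc (Suc k))"
proof -
  have "cf_rem \<alpha> (Suc k) * (1 / cf_rem \<alpha> (Suc k)) = 1" using cf_rem_bounds[of "Suc k"] by simp
  then have "cf_err \<alpha> k = cf_err \<alpha> (Suc k) * (1 / cf_rem \<alpha> (Suc k))"
    unfolding cf_err_Suc by (simp only: mult.assoc mult_1_right)
  then show ?thesis
    unfolding one_div_cf_rem by (simp add: cf_err_Suc algebra_simps del: cf_rem.simps(2))
qed

text \<open>The shared recursion of \<open>cf_q\<close> and \<open>cf_p\<close> matches
  \<open>cf_err_rec\<close> up to sign. The alternating sign is the direction in which
  \<open>cf_q \<alpha> k\<close> rotation steps drift.\<close>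

lemma cf_q_cf_p_err: "real (cf_q \<alpha> k) * \<alpha> - real (cf_p \<alpha> k) = (-1) ^ k * cf_err \<alpha> k"
proof (induction k rule: induct_nat_012)
  case 1
  have "\<alpha> * (1 / \<alpha>) = 1" using pos by simp
  then have "\<alpha> * (real (cf_a \<alpha> (Suc 0)) + cf_rem \<alpha> (Suc 0)) = 1"
    using one_div_cf_rem[of 0] by simp
  then show ?case by (simp add: cf_err_Suc algebra_simps del: cf_rem.simps(2))
next
  case (ge2 k)
  have "real (cf_q \<alpha> (Suc (Suc k))) * \<alpha> - real (cf_p \<alpha> (Suc (Suc k)))
      = real (cf_a \<alpha> (Suc (Suc k))) * (real (cf_q \<alpha> (Suc k)) * \<alpha> - real (cf_p \<alpha> (Suc k)))
        + (real (cf_q \<alpha> k) * \<alpha> - real (cf_p \<alpha> k))"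
    by (simp add: algebra_simps)
  also have "\<dots> = (-1) ^ k * (cf_err \<alpha> k - real (cf_a \<alpha> (Suc (Suc k))) * cf_err \<alpha> (Suc k))"
    unfolding ge2 by (simp add: algebra_simps)
  also have "\<dots> = (-1) ^ k * cf_err \<alpha> (Suc (Suc k))"
    using cf_err_rec[of k] by simp
  finally show ?case by simp
qed simp

text \<open>Growth is strict already at \<open>k = 0\<close> because \<open>\<alpha> < 1 / 2\<close>
  makes the first partial quotient at least 2.\<close>

lemma cf_q_less: "cf_q \<alpha> k < cf_q \<alpha> (Suc k)" and cf_q_pos: "0 < cf_q \<alpha> k"
proof -
  have "cf_q \<alpha> k < cf_q \<alpha> (Suc k) \<and> 0 < cf_q \<alpha> k"
  proof (induction k)
    case 0 then show ?case using cf_a_1 by simp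
  next
    case (Suc k)
    have "1 * cf_q \<alpha> (Suc k) \<le> cf_a \<alpha> (k + 2) * cf_q \<alpha> (Suc k)"
      using cf_a_pos[of "Suc k"] by (intro mult_right_mono) auto
    then show ?case using Suc unfolding cf_q.simps by linarith
  qed
  then show "cf_q \<alpha> k < cf_q \<alpha> (Suc k)" "0 < cf_q \<alpha> k" by auto
qed

lemma cf_q_mono: "j \<le> k \<Longrightarrow> cf_q \<alpha> j \<le> cf_q \<alpha> k"
  by (rule lift_Suc_mono_le[of "cf_q \<alpha>"]) (use cf_q_less less_imp_le in auto)

text \<open>As \<open>cf_err \<alpha> k \<le> \<alpha> < 1 / 2\<close>, any integer other than
  \<open>cf_p \<alpha> k\<close> is farther than 1/2 away.\<close>

lemma cf_err_le_dist: "cf_err \<alpha> k \<le> \<bar>real (cf_q \<alpha> k) * \<alpha> - of_int c\<bar>"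
proof (cases "c = int (cf_p \<alpha> k)")
  case True
  then have "\<bar>real (cf_q \<alpha> k) * \<alpha> - of_int c\<bar> = \<bar>(-1) ^ k * cf_err \<alpha> k\<bar>"
    using cf_q_cf_p_err[of k] by simp
  then show ?thesis by (simp add: abs_mult)
next
  case False
  have "\<bar>real (cf_q \<alpha> k) * \<alpha> - real (cf_p \<alpha> k)\<bar> = cf_err \<alpha> k"
    using cf_q_cf_p_err[of k] cf_err_pos[of k] by (simp add: abs_mult)
  moreover have "1 \<le> \<bar>real_of_int c - real (cf_p \<alpha> k)\<bar>" using False by linarith
  ultimately show ?thesis using cf_err_le[of k] less_half by linarith
qed

section \<open>Slopes other than the golden one\<close>

text \<open>Denominators increase, so a period below \<open>cf_q \<alpha> (Suc k)\<close> leaves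
  only the indices up to \<open>k\<close> as candidates.\<close>

lemma min_abelian_period_not_cf_q:
  assumes "abelian_period w m" "m < cf_q \<alpha> (Suc k)"
    and "\<And>j. j \<le> k \<Longrightarrow> \<not> abelian_period w (cf_q \<alpha> j)"
  shows "min_abelian_period w \<notin> {cf_q \<alpha> k | k. k \<ge> 0}"
proof
  assume "min_abelian_period w \<in> {cf_q \<alpha> k | k. k \<ge> 0}"
  then obtain j where j: "min_abelian_period w = cf_q \<alpha> j" by auto
  have "abelian_period w (min_abelian_period w)" "min_abelian_period w \<le> m"
    unfolding min_abelian_period_def using assms(1) by (rule LeastI, rule Least_le)
  then have "k < j" using assms(3)[of j] j by (metis not_le)
  then show False
    using cf_q_mono[of "Suc k" j] assms(2) j \<open>min_abelian_period w \<le> m\<close> by simp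
qed

lemma first_quotient_counterexample:
  assumes "3 \<le> cf_a \<alpha> (Suc 0)"
  shows "\<exists>w \<in> slope_factors \<alpha>. w \<noteq> [] \<and> min_abelian_period w \<notin> {cf_q \<alpha> k | k. k \<ge> 0}"
proof -
  \<comment> \<open>This intercept puts the orbit at \<open>1 - 2 * \<alpha>\<close>,
    \<open>1 - \<alpha>\<close> and 1, so only the second step reaches an integer.\<close>
  define w where "w = slope_word \<alpha> (1 - 2 * \<alpha>) 2"
  have "\<lfloor>1 - 2 * \<alpha>\<rfloor> = 0" "\<lfloor>1 - 2 * \<alpha> + \<alpha>\<rfloor> = 0"
    using pos less_half by (simp_all add: floor_eq_iff)
  then have w: "w = [0, 1]"
    by (simp add: w_def slope_word_def upt_rec)
  have not1: "\<not> abelian_period w 1"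
  proof
    assume "abelian_period w 1"
    then obtain u v z e c where "w = u @ v @ z" "length u < 1" "length z < 1" "0 < e"
      "length v = e * 1" "count_list v 1 = e * c"
      by (rule abelian_periodD) (auto simp: w)
    then have "v = [0, 1]" "e = 2" "1 = e * c" using w by auto
    then show False by simp
  qed
  have "abelian_period w 2"
    unfolding w_def by (rule abelian_period_length_slope_word) (use pos less_one in auto)
  then have "min_abelian_period w \<notin> {cf_q \<alpha> k | k. k \<ge> 0}"
    by (rule min_abelian_period_not_cf_q[where k = 0]) (use assms not1 in auto)
  moreover have "w \<in> slope_factors \<alpha>"
    unfolding w_def using pos less_one by (rule slope_word_in_slope_factors)
  ultimately show ?thesis using w by auto
qed

lemma later_quotient_counterexample:
  assumes "2 \<le> cf_a \<alpha> (Suc (Suc i))"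
  shows "\<exists>w \<in> slope_factors \<alpha>. w \<noteq> [] \<and> min_abelian_period w \<notin> {cf_q \<alpha> k | k. k \<ge> 0}"
proof -
  define k where "k = Suc i"
  define \<delta> where "\<delta> = cf_err \<alpha> k"
  define q where "q = cf_q \<alpha> k"
  have \<delta>: "0 < \<delta>" using cf_err_pos by (simp add: \<delta>_def)
  \<comment> \<open>The large quotient makes \<open>\<delta>\<close> fit twice into the preceding
    error, which is at most \<open>\<alpha>\<close>; hence heads and tails for the period
    \<open>2 * q\<close> fit automatically.\<close>
  have "2 * \<delta> \<le> real (cf_a \<alpha> (Suc (Suc i))) * \<delta>" using assms \<delta> by simp
  then have \<delta>2: "2 * \<delta> \<le> \<alpha>"
    using cf_err_rec[of i] cf_err_pos[of "Suc (Suc i)"] cf_err_le[of i] by (simp add: \<delta>_def k_def)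
  have q: "0 < q" by (simp add: q_def cf_q_pos)
  have "2 * cf_q \<alpha> (Suc i) \<le> cf_a \<alpha> (i + 2) * cf_q \<alpha> (Suc i)"
    using assms by (intro mult_right_mono) auto
  then have q2: "2 * q < cf_q \<alpha> (Suc k)"
    using cf_q_pos[of i] unfolding q_def k_def cf_q.simps by linarith
  \<comment> \<open>\<open>e\<close> is the largest number of blocks of length \<open>2 * q\<close>
    whose total drift stays below 1.\<close>
  obtain e :: nat where e: "0 < e" "2 * real e * \<delta> < 1" "1 \<le> 2 * (real e + 1) * \<delta>"
  proof
    let ?y = "1 / (2 * \<delta>)"
    have y: "1 < ?y" using \<delta> \<delta>2 less_half by (simp add: field_simps)
    show "0 < nat (\<lceil>?y\<rceil> - 1)" using y by linarith
    have "real (nat (\<lceil>?y\<rceil> - 1)) < ?y" "?y \<le> real (nat (\<lceil>?y\<rceil> - 1)) + 1" using y by linarith+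
    then show "2 * real (nat (\<lceil>?y\<rceil> - 1)) * \<delta> < 1" "1 \<le> 2 * (real (nat (\<lceil>?y\<rceil> - 1)) + 1) * \<delta>"
      using \<delta> by (simp_all only: pos_less_divide_eq pos_divide_le_eq mult_pos_pos zero_less_numeral mult_ac)
  qed
  \<comment> \<open>Head and tail are as long as possible, so that
    \<open>n + 2 = (2 * e + 4) * q\<close>.\<close>
  define r where "r = 2 * q - 1"
  define n where "n = r + e * (2 * q) + r"
  \<comment> \<open>The drift runs upwards from 0 for even \<open>k\<close> and downwards to 0 for
    odd \<open>k\<close>.\<close>
  define f where "f = (if even k then 0 else 2 * real e * \<delta>)"
  define w where "w = slope_word \<alpha> (f - real r * \<alpha>) n"
  have d: "real (2 * q) * \<alpha> - real (2 * cf_p \<alpha> k) = (if even k then 2 * \<delta> else - (2 * \<delta>))"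
    using cf_q_cf_p_err[of k] by (auto simp: \<delta>_def q_def)
  have "abelian_period w (2 * q)"
    unfolding w_def
  proof (rule abelian_period_of_approximation[OF pos less_half refl])
    show "\<bar>real (2 * q) * \<alpha> - real (2 * cf_p \<alpha> k)\<bar> \<le> \<alpha>" unfolding d using \<delta> \<delta>2 by simp
    show "r < 2 * q" "r + e * (2 * q) \<le> n" "n < r + (e + 1) * (2 * q)"
      using q by (auto simp: r_def n_def)
    show "f = frac (f - real r * \<alpha> + real r * \<alpha>)"
      using e \<delta> by (simp add: f_def frac_eq)
    show "0 \<le> f + real e * (real (2 * q) * \<alpha> - real (2 * cf_p \<alpha> k))"
      "f + real e * (real (2 * q) * \<alpha> - real (2 * cf_p \<alpha> k)) < 1"
      unfolding d using e \<delta> by (auto simp: f_def algebra_simps)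
  qed (rule e)
  \<comment> \<open>The length forces at least \<open>2 * e + 2\<close> blocks of length
    \<open>cf_q \<alpha> j\<close>, and their drift is at least
    \<open>2 * (e + 1) * \<delta> \<ge> 1\<close>.\<close>
  moreover have "\<not> abelian_period w (cf_q \<alpha> j)" if "j \<le> k" for j
  proof
    assume "abelian_period w (cf_q \<alpha> j)"
    then obtain e' c where e': "n + 2 \<le> (e' + 2) * cf_q \<alpha> j"
      "real e' * \<bar>real (cf_q \<alpha> j) * \<alpha> - of_int c\<bar> < 1"
      unfolding w_def by (rule abelian_period_slope_wordD[OF pos less_one])
    have "(e' + 2) * cf_q \<alpha> j \<le> (e' + 2) * q"
      using cf_q_mono[OF that] unfolding q_def by (rule mult_left_mono) simp
    moreover have "n + 2 = (2 * e + 4) * q" using q by (simp add: n_def r_def algebra_simps)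
    ultimately have "(2 * e + 4) * q \<le> (e' + 2) * q" using e'(1) by linarith
    then have "2 * e + 4 \<le> e' + 2" unfolding mult_le_cancel2 using q by blast
    then have "2 * (real e + 1) * \<delta> \<le> real e' * \<delta>"
      using \<delta> by (intro mult_right_mono) auto
    also have "\<dots> \<le> real e' * \<bar>real (cf_q \<alpha> j) * \<alpha> - of_int c\<bar>"
      using cf_err_antimono[OF that] cf_err_le_dist[of j c] by (intro mult_left_mono) (auto simp: \<delta>_def)
    finally show False using e(3) e'(2) by linarith
  qed
  ultimately have "min_abelian_period w \<notin> {cf_q \<alpha> k | k. k \<ge> 0}"
    using q2 by (intro min_abelian_period_not_cf_q) auto
  moreover have "w \<in> slope_factors \<alpha>"
    unfolding w_def using pos less_one by (rule slope_word_in_slope_factors)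
  moreover have "length w \<noteq> 0" using q e(1) by (simp add: w_def n_def)
  ultimately show ?thesis by auto
qed

section \<open>Uniqueness of the slope with partial quotients 2, 1, 1, ..\<close>

lemma golden_of_quotients:
  assumes "cf_a \<alpha> (Suc 0) = 2" "\<And>i. cf_a \<alpha> (Suc (Suc i)) = 1"
  shows "\<alpha> = 1 / ((1 + sqrt 5) / 2) ^ 2"
proof -
  \<comment> \<open>The inverse golden ratio, the positive fixed point of
    \<open>u = 1 / (1 + u)\<close>.\<close>
  define \<beta> where "\<beta> = (sqrt 5 - 1) / 2"
  have "sqrt 5 ^ 2 = (5 :: real)" by simp
  then have \<beta>2: "\<beta> * \<beta> = 1 - \<beta>" by (simp add: \<beta>_def power2_eq_square field_simps)
  have "1 < sqrt (5 :: real)" "sqrt (5 :: real) < 3" by (simp, rule real_less_lsqrt) auto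
  then have \<beta>01: "0 < \<beta>" "\<beta> < 1" by (auto simp: \<beta>_def)
  define t where "t = cf_rem \<alpha> (Suc 0)"
  \<comment> \<open>The map \<open>v \<mapsto> 1 / (1 + v)\<close> shrinks the distance to
    \<open>\<beta>\<close> by the factor \<open>u * \<beta> \<le> \<beta>\<close>. All remainders
    lie in the unit interval, so iterating forces \<open>t = \<beta>\<close>.\<close>
  have step: "\<bar>cf_rem \<alpha> (Suc i) - \<beta>\<bar> \<le> \<beta> * \<bar>cf_rem \<alpha> (Suc (Suc i)) - \<beta>\<bar>" for i
  proof -
    define u where "u = cf_rem \<alpha> (Suc i)"
    define v where "v = cf_rem \<alpha> (Suc (Suc i))"
    have uv: "0 < u" "u < 1" unfolding u_def by (rule cf_rem_bounds)+
    have "1 / u = 1 + v" using one_div_cf_rem[of "Suc i"] assms(2)[of i] by (simp add: u_def v_def)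
    then have "u * (1 + v) = 1" using uv by (simp add: field_simps)
    then have "u - \<beta> = u - \<beta> * (u * (1 + v))" by simp
    also have "\<dots> = u * ((1 - \<beta>) - \<beta> * v)" by (simp add: algebra_simps)
    also have "\<dots> = u * \<beta> * (\<beta> - v)" unfolding \<beta>2[symmetric] by (simp add: algebra_simps)
    finally have "\<bar>u - \<beta>\<bar> = u * (\<beta> * \<bar>v - \<beta>\<bar>)"
      using uv \<beta>01 by (simp add: abs_mult abs_minus_commute)
    also have "\<dots> \<le> 1 * (\<beta> * \<bar>v - \<beta>\<bar>)" using uv \<beta>01 by (intro mult_right_mono) auto
    finally show ?thesis by (simp add: u_def v_def)
  qed
  have bound: "\<bar>t - \<beta>\<bar> \<le> \<beta> ^ i * \<bar>cf_rem \<alpha> (Suc i) - \<beta>\<bar>" for i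
  proof (induction i)
    case (Suc i)
    have "\<beta> ^ i * \<bar>cf_rem \<alpha> (Suc i) - \<beta>\<bar> \<le> \<beta> ^ i * (\<beta> * \<bar>cf_rem \<alpha> (Suc (Suc i)) - \<beta>\<bar>)"
      using step[of i] \<beta>01 by (intro mult_left_mono) auto
    with Suc show ?case by (simp add: algebra_simps del: cf_rem.simps)
  qed (simp add: t_def)
  have "\<bar>t - \<beta>\<bar> \<le> \<beta> ^ i" for i
  proof -
    have "\<bar>cf_rem \<alpha> (Suc i) - \<beta>\<bar> \<le> 1"
      using cf_rem_bounds[of "Suc i"] \<beta>01 unfolding abs_le_iff by linarith
    then have "\<beta> ^ i * \<bar>cf_rem \<alpha> (Suc i) - \<beta>\<bar> \<le> \<beta> ^ i * 1"
      using \<beta>01 by (intro mult_left_mono) auto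
    then show ?thesis using bound[of i] by linarith
  qed
  moreover have "(\<lambda>i. \<beta> ^ i) \<longlonglongrightarrow> 0" using \<beta>01 by (intro LIMSEQ_realpow_zero) auto
  ultimately have "\<bar>t - \<beta>\<bar> \<le> 0"
    by (intro LIMSEQ_le_const[of "\<lambda>i. \<beta> ^ i"]) auto
  then have "1 / \<alpha> = 2 + \<beta>" using one_div_cf_rem[of 0] assms(1) by (simp add: t_def)
  moreover have "((1 + sqrt 5) / 2) ^ 2 = 2 + \<beta>" by (simp add: \<beta>_def power2_eq_square field_simps)
  ultimately show ?thesis by (metis div_by_1 divide_divide_eq_right mult_1)
qed

end

section \<open>The golden slope\<close>

text \<open>
  The arc has length \<open>\<delta> + \<delta>'\<close>. If its first visit happened at a time \<open>r \<ge> q\<close>, then either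
  going back by \<open>q\<close> (a shift by \<open>-\<delta>\<close>) or by \<open>q'\<close> (a shift by \<open>\<delta>'\<close>) would stay inside it.
\<close>
lemma rotation_hits_arc:
  fixes x \<theta> \<delta> \<delta>' :: real and q q' :: nat and p p' :: int
  assumes q: "real q * \<theta> = of_int p + \<delta>" "0 < \<delta>" and q': "real q' * \<theta> = of_int p' - \<delta>'" "0 < \<delta>'"
    and "0 < q'" "q' \<le> q"
  obtains r l where "r < q" "0 \<le> x + real r * \<theta> - of_int l" "x + real r * \<theta> - of_int l < \<delta> + \<delta>'"
proof -
  define H where "H r \<longleftrightarrow> (\<exists>l::int. 0 \<le> x + real r * \<theta> - of_int l \<and> x + real r * \<theta> - of_int l < \<delta> + \<delta>')" for r
  \<comment> \<open>Some hit exists: every \<open>q\<close> steps advance the orbit by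
    \<open>\<delta>\<close>, so the first of these points at or past
    \<open>\<lceil>x\<rceil>\<close> lands within \<open>\<delta>\<close> of it.\<close>
  define y where "y = (of_int \<lceil>x\<rceil> - x) / \<delta>"
  define j where "j = nat \<lceil>y\<rceil>"
  have "0 \<le> y" using q by (simp add: y_def)
  then have "y \<le> real j" "real j < y + 1" by (auto simp: j_def) linarith+
  then have "y * \<delta> \<le> real j * \<delta>" "real j * \<delta> < (y + 1) * \<delta>" using q by auto
  moreover have "y * \<delta> = of_int \<lceil>x\<rceil> - x" using q by (simp add: y_def)
  ultimately have j: "of_int \<lceil>x\<rceil> \<le> x + real j * \<delta>" "x + real j * \<delta> < of_int \<lceil>x\<rceil> + \<delta>"
    by (simp_all add: distrib_right)
  have "x + real (j * q) * \<theta> = x + real j * (real q * \<theta>)" by simp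
  then have "x + real (j * q) * \<theta> - of_int (int j * p + \<lceil>x\<rceil>) = x + real j * \<delta> - of_int \<lceil>x\<rceil>"
    unfolding q(1) by (simp add: algebra_simps)
  then have "H (j * q)"
    unfolding H_def using j q'(2) by (intro exI[of _ "int j * p + \<lceil>x\<rceil>"]) simp
  define r where "r = (LEAST r. H r)"
  have "H r" unfolding r_def using \<open>H (j * q)\<close> by (rule LeastI)
  have least: "\<not> H r'" if "r' < r" for r' using that not_less_Least unfolding r_def by blast
  obtain l where l: "0 \<le> x + real r * \<theta> - of_int l" "x + real r * \<theta> - of_int l < \<delta> + \<delta>'"
    using \<open>H r\<close> unfolding H_def by blast
  have "r < q"
  proof (rule ccontr)
    assume "\<not> r < q"
    then have rq: "real (r - q) * \<theta> = real r * \<theta> - (of_int p + \<delta>)"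
      "real (r - q') * \<theta> = real r * \<theta> - (of_int p' - \<delta>')"
      unfolding q(1)[symmetric] q'(1)[symmetric] using assms(6)
      by (simp_all add: of_nat_diff left_diff_distrib)
    show False
    proof (cases "\<delta> \<le> x + real r * \<theta> - of_int l")
      case True
      then have "H (r - q)"
        unfolding H_def rq using l q by (intro exI[of _ "l - p"]) simp
      then show False using least[of "r - q"] \<open>\<not> r < q\<close> assms(5,6) by simp
    next
      case False
      then have "H (r - q')"
        unfolding H_def rq using l q' by (intro exI[of _ "l - p'"]) simp
      then show False using least[of "r - q'"] \<open>\<not> r < q\<close> assms(5,6) by simp
    qed
  qed
  then show ?thesis using that l by blast
qed

lemma frac_eqI: "z = of_int l + g \<Longrightarrow> 0 \<le> g \<Longrightarrow> g < 1 \<Longrightarrow> frac z = g"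
  by (simp add: frac_unique_iff)

text \<open>\<open>rotation_hits_arc\<close> finds an early orbit point in an arc at one end of
  \<open>[0, 1)\<close>; the assumed inequality leaves room for \<open>N\<close> drifts towards the
  other end.\<close>

lemma (in irrational_slope) rotation_start:
  fixes x :: real
  assumes "cf_err \<alpha> (Suc j) + cf_err \<alpha> j + real N * cf_err \<alpha> (Suc j) < 1"
    and d: "d = real (cf_q \<alpha> (Suc j)) * \<alpha> - real (cf_p \<alpha> (Suc j))"
  obtains r where "r < cf_q \<alpha> (Suc j)"
    "0 \<le> frac (x + real r * \<alpha>) + real N * d" "frac (x + real r * \<alpha>) + real N * d < 1"
proof -
  define \<delta>' where "\<delta>' = cf_err \<alpha> j"
  define \<delta> where "\<delta> = cf_err \<alpha> (Suc j)"
  have \<delta>: "0 < \<delta>" "0 < \<delta>'" using cf_err_pos by (auto simp: \<delta>_def \<delta>'_def)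
  have small: "\<delta> + \<delta>' + real N * \<delta> < 1" using assms(1) by (simp add: \<delta>_def \<delta>'_def)
  have N\<delta>: "0 \<le> real N * \<delta>" using \<delta> by simp
  have q: "0 < cf_q \<alpha> j" "cf_q \<alpha> j \<le> cf_q \<alpha> (Suc j)"
    using cf_q_pos[of j] cf_q_less[of j] by simp_all
  have errs: "real (cf_q \<alpha> (Suc j)) * \<alpha> = real (cf_p \<alpha> (Suc j)) - (-1) ^ j * \<delta>"
    "real (cf_q \<alpha> j) * \<alpha> = real (cf_p \<alpha> j) + (-1) ^ j * \<delta>'"
    using cf_q_cf_p_err[of j] cf_q_cf_p_err[of "Suc j"] by (simp_all add: \<delta>_def \<delta>'_def)
  show ?thesis
  proof (cases "even j")
    case False
    obtain r l where r: "r < cf_q \<alpha> (Suc j)" "0 \<le> x + real r * \<alpha> - of_int l"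
      "x + real r * \<alpha> - of_int l < \<delta> + \<delta>'"
      by (rule rotation_hits_arc[of "cf_q \<alpha> (Suc j)" \<alpha> "int (cf_p \<alpha> (Suc j))" \<delta>
            "cf_q \<alpha> j" "int (cf_p \<alpha> j)" \<delta>' x])
        (use False errs \<delta> q in \<open>simp_all del: cf_q.simps cf_p.simps\<close>)
    have "frac (x + real r * \<alpha>) = x + real r * \<alpha> - of_int l"
      using r small N\<delta> by (intro frac_eqI[of _ l]) auto
    moreover have "d = \<delta>" using d errs(1) False by simp
    ultimately show ?thesis using that[OF r(1)] r small N\<delta> by simp
  next
    case True
    \<comment> \<open>The drift is negative, so the rotation is reversed. The slack
      \<open>\<epsilon>\<close> turns the reflected arc into
      \<open>(N * \<delta>, 1 - \<epsilon>]\<close>, whose closed end stays below 1.\<close>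
    define \<epsilon> where "\<epsilon> = 1 - (\<delta> + \<delta>' + real N * \<delta>)"
    obtain r l where r: "r < cf_q \<alpha> (Suc j)" "0 \<le> (- x - \<epsilon>) + real r * (- \<alpha>) - of_int l"
      "(- x - \<epsilon>) + real r * (- \<alpha>) - of_int l < \<delta> + \<delta>'"
      by (rule rotation_hits_arc[of "cf_q \<alpha> (Suc j)" "- \<alpha>" "- int (cf_p \<alpha> (Suc j))" \<delta>
            "cf_q \<alpha> j" "- int (cf_p \<alpha> j)" \<delta>' "- x - \<epsilon>"])
        (use True errs \<delta> q in \<open>simp_all del: cf_q.simps cf_p.simps\<close>)
    have "frac (x + real r * \<alpha>) = x + real r * \<alpha> + of_int l + 1"
      using r small N\<delta> by (intro frac_eqI[of _ "- l - 1"]) (auto simp: \<epsilon>_def)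
    moreover have "d = - \<delta>" using d errs(1) True by simp
    ultimately show ?thesis using that[OF r(1)] r small N\<delta> by (simp add: \<epsilon>_def)
  qed
qed

text \<open>\<open>\<beta>\<close> is the inverse golden ratio and
  \<open>\<alpha> = \<beta> ^ 2\<close>. The quadratic relation makes every power of
  \<open>\<beta>\<close> linear in \<open>\<beta>\<close>.\<close>

locale golden_slope = irrational_slope +
  fixes \<beta> :: real
  assumes beta_square: "\<beta> * \<beta> = 1 - \<beta>" and beta_pos: "0 < \<beta>" and beta_less: "\<beta> < 1"
    and alpha_eq: "\<alpha> = 1 - \<beta>"
begin

lemma beta_bounds: "309 / 500 < \<beta>" "\<beta> < 6181 / 10000"
proof -
  show "309 / 500 < \<beta>"
  proof (rule ccontr)
    assume A: "\<not> 309 / 500 < \<beta>"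
    then have "\<beta> * \<beta> \<le> (309 / 500) * (309 / 500)" using beta_pos by (intro mult_mono) auto
    then show False using beta_square A by simp
  qed
  show "\<beta> < 6181 / 10000"
  proof (rule ccontr)
    assume A: "\<not> \<beta> < 6181 / 10000"
    then have "(6181 / 10000) * (6181 / 10000) \<le> \<beta> * \<beta>" by (intro mult_mono) auto
    then show False using beta_square A by simp
  qed
qed

lemma inverse_alpha: "1 / \<alpha> = 2 + \<beta>" and inverse_beta: "1 / \<beta> = 1 + \<beta>"
proof -
  have "\<alpha> * (2 + \<beta>) = 1" "\<beta> * (1 + \<beta>) = 1"
    using beta_square by (simp_all add: alpha_eq algebra_simps)
  then show "1 / \<alpha> = 2 + \<beta>" "1 / \<beta> = 1 + \<beta>"
    using pos beta_pos by (simp_all add: divide_eq_eq mult.commute)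
qed

section \<open>Continued fraction and approximation properties of the golden slope\<close>

lemma cf_rem_golden: "cf_rem \<alpha> (Suc k) = \<beta>"
proof (induction k)
  case 0
  then show ?case using beta_pos beta_less by (simp add: inverse_alpha frac_unique_iff)
next
  case (Suc k)
  then show ?case unfolding cf_rem.simps(2)[of _ "Suc k"]
    using beta_pos beta_less by (simp add: inverse_beta frac_unique_iff del: cf_rem.simps)
qed

lemma cf_a_golden: "cf_a \<alpha> (Suc 0) = 2" "cf_a \<alpha> (Suc (Suc k)) = 1"
  using one_div_cf_rem[of 0] one_div_cf_rem[of "Suc k"] inverse_alpha inverse_beta
  unfolding cf_rem_golden by simp_all

lemma cf_q_golden: "cf_q \<alpha> (Suc 0) = 2" "cf_q \<alpha> (Suc (Suc k)) = cf_q \<alpha> (Suc k) + cf_q \<alpha> k"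
  using cf_a_golden by simp_all

lemma cf_err_golden: "cf_err \<alpha> (Suc k) = cf_err \<alpha> k * \<beta>"
  unfolding cf_err_Suc cf_rem_golden ..

text \<open>Expand \<open>(m, c)\<close> in two consecutive convergents. Since
  \<open>Q < m < Q + R\<close>, the coefficients \<open>a\<close> and \<open>b\<close> have opposite
  signs or \<open>a = 0\<close>; the errors of the convergents alternate in sign, so the
  contributions add up.\<close>

lemma second_best_approximation:
  fixes c :: int
  assumes "cf_q \<alpha> (Suc j) < m" "m < cf_q \<alpha> (Suc (Suc j))"
  shows "2 * cf_err \<alpha> j \<le> \<bar>real m * \<alpha> - of_int c\<bar>"
proof -
  define Q where "Q = int (cf_q \<alpha> (Suc j))"
  define R where "R = int (cf_q \<alpha> j)"
  define P where "P = int (cf_p \<alpha> (Suc j))"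
  define O' where "O' = int (cf_p \<alpha> j)"
  define \<sigma> :: int where "\<sigma> = (-1) ^ j"
  have det: "P * R - O' * Q = \<sigma>"
    using cf_p_cf_q_det[of \<alpha> j] by (simp only: P_def Q_def R_def O'_def \<sigma>_def)
  have \<sigma>2: "\<sigma> * \<sigma> = 1" by (simp add: \<sigma>_def flip: power_mult_distrib)
  \<comment> \<open>Cramer's rule; the determinant \<open>\<sigma>\<close> is its own
    inverse.\<close>
  define a where "a = \<sigma> * (c * R - int m * O')"
  define b where "b = \<sigma> * (int m * P - c * Q)"
  have "a * Q + b * R = int m * (\<sigma> * (P * R - O' * Q))"
    by (simp add: a_def b_def algebra_simps)
  then have m: "int m = a * Q + b * R" by (simp add: det \<sigma>2)
  have "a * P + b * O' = c * (\<sigma> * (P * R - O' * Q))"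
    by (simp add: a_def b_def algebra_simps)
  then have c: "c = a * P + b * O'" by (simp add: det \<sigma>2)
  have QR: "0 < R" "R < Q" using cf_q_pos[of j] cf_q_less[of j] by (auto simp: R_def Q_def)
  have ab: "Q < a * Q + b * R" "a * Q + b * R < Q + R"
    using assms unfolding cf_q_golden(2) m[symmetric] by (simp_all add: Q_def R_def)
  define \<delta>' where "\<delta>' = cf_err \<alpha> j"
  define \<delta> where "\<delta> = cf_err \<alpha> (Suc j)"
  have dQ: "of_int Q * \<alpha> - of_int P = - (of_int \<sigma> * \<delta>)"
    using cf_q_cf_p_err[of "Suc j"] by (simp add: Q_def P_def \<sigma>_def \<delta>_def del: cf_q.simps cf_p.simps)
  have dR: "of_int R * \<alpha> - of_int O' = of_int \<sigma> * \<delta>'"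
    using cf_q_cf_p_err[of j] by (simp add: R_def O'_def \<sigma>_def \<delta>'_def)
  have "real m = of_int a * of_int Q + of_int b * of_int R"
    by (metis m of_int_add of_int_mult of_int_of_nat_eq)
  then have "real m * \<alpha> - of_int c
      = of_int a * (of_int Q * \<alpha> - of_int P) + of_int b * (of_int R * \<alpha> - of_int O')"
    by (simp add: c algebra_simps)
  also have "\<dots> = of_int \<sigma> * (of_int b * \<delta>' - of_int a * \<delta>)"
    unfolding dQ dR by (simp add: algebra_simps)
  finally have dist: "\<bar>real m * \<alpha> - of_int c\<bar> = \<bar>of_int b * \<delta>' - of_int a * \<delta>\<bar>"
    by (simp add: abs_mult \<sigma>_def)
  have \<delta>: "0 < \<delta>" "0 < \<delta>'" "\<delta> = \<delta>' * \<beta>"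
    using cf_err_pos[of j] cf_err_pos[of "Suc j"] cf_err_golden[of j] by (auto simp: \<delta>_def \<delta>'_def)
  have "\<delta>' * (1 / 2) \<le> \<delta>' * \<beta>" using \<delta> beta_bounds by (intro mult_left_mono) auto
  then have \<delta>2: "\<delta>' \<le> 2 * \<delta>" using \<delta>(3) by simp
  \<comment> \<open>The first case gives \<open>2 * \<delta>'\<close> from \<open>b\<close> alone,
    the second gives \<open>\<delta>' + 2 * \<delta>\<close> with
    \<open>\<delta>' \<le> 2 * \<delta>\<close>.\<close>
  have "a \<le> 0 \<and> 2 \<le> b \<or> 2 \<le> a \<and> b \<le> - 1"
  proof (cases "1 \<le> b")
    case True
    have "a \<le> 0"
    proof (rule ccontr)
      assume "\<not> a \<le> 0"
      then have "1 * Q \<le> a * Q" using QR by (intro mult_right_mono) auto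
      moreover have "1 * R \<le> b * R" using QR True by (intro mult_right_mono) auto
      ultimately show False using ab by linarith
    qed
    then have "a * Q \<le> 0" using QR by (simp add: mult_nonpos_nonneg)
    then have "b \<noteq> 1" using ab QR by auto
    then show ?thesis using True \<open>a \<le> 0\<close> by linarith
  next
    case False
    then have "b * R \<le> 0" using QR by (simp add: mult_nonpos_nonneg)
    then have "1 * Q < a * Q" using ab by linarith
    then have "2 \<le> a" using QR by simp
    then have "2 * Q \<le> a * Q" using QR by (intro mult_right_mono) auto
    then have "b * R \<noteq> 0" using ab QR by linarith
    then have "b \<noteq> 0" by auto
    then show ?thesis using False \<open>2 \<le> a\<close> by linarith
  qed
  then have "2 * \<delta>' \<le> \<bar>of_int b * \<delta>' - of_int a * \<delta>\<bar>"
  proof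
    assume A: "a \<le> 0 \<and> 2 \<le> b"
    then have "of_int a * \<delta> \<le> 0" using \<delta> by (simp add: mult_nonpos_nonneg)
    moreover have "2 * \<delta>' \<le> of_int b * \<delta>'" using A \<delta> by (intro mult_right_mono) auto
    ultimately show ?thesis by linarith
  next
    assume A: "2 \<le> a \<and> b \<le> - 1"
    then have "2 * \<delta> \<le> of_int a * \<delta>" using \<delta> by (intro mult_right_mono) auto
    moreover have "of_int b * \<delta>' \<le> (- 1) * \<delta>'" using A \<delta> by (intro mult_right_mono) auto
    ultimately show ?thesis using \<delta>2 by linarith
  qed
  then show ?thesis using dist by (simp add: \<delta>'_def)
qed

lemma cf_q_ratio: "3 * cf_q \<alpha> (Suc (Suc (Suc j))) \<le> 5 * cf_q \<alpha> (Suc (Suc j))"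
proof -
  have "cf_q \<alpha> (Suc j) \<le> 2 * cf_q \<alpha> j"
  proof (cases j)
    case (Suc i)
    show ?thesis unfolding Suc using cf_q_golden(2)[of i] cf_q_less[of i] by linarith
  qed (use cf_q_golden(1) in simp)
  then show ?thesis using cf_q_golden(2)[of "Suc j"] cf_q_golden(2)[of j] by linarith
qed

text \<open>The drift bound for \<open>e\<close> blocks of length \<open>m\<close> gives
  \<open>e * \<delta> \<le> \<beta> / 2\<close>. As \<open>m\<close> exceeds the smaller denominator
  by a factor of at most 5/3, \<open>N\<close> is at most \<open>5 * (e + 2) / 3\<close>, so the
  total drift fits once \<open>\<delta>\<close> is small.\<close>

lemma covered_blocks:
  assumes m: "cf_q \<alpha> (Suc j) < m" "m < cf_q \<alpha> (Suc (Suc j))" and "1 \<le> j"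
    and e: "real e * (2 * cf_err \<alpha> j) < 1" and n: "n + 2 \<le> (e + 2) * m" and N: "N * cf_q \<alpha> (Suc j) \<le> n"
  shows "cf_err \<alpha> (Suc j) + cf_err \<alpha> j + real N * cf_err \<alpha> (Suc j) < 1"
proof -
  define \<delta>' where "\<delta>' = cf_err \<alpha> j"
  define \<delta> where "\<delta> = cf_err \<alpha> (Suc j)"
  have \<delta>: "0 < \<delta>" "0 < \<delta>'" "\<delta> = \<delta>' * \<beta>"
    using cf_err_pos[of j] cf_err_pos[of "Suc j"] cf_err_golden[of j] by (auto simp: \<delta>_def \<delta>'_def)
  have "\<delta> * (1 + \<beta>) = \<delta>' * (\<beta> + \<beta> * \<beta>)" by (simp add: \<delta>(3) algebra_simps)
  then have \<delta>': "\<delta>' = \<delta> * (1 + \<beta>)" by (simp add: beta_square)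
  have "real e * \<delta> = (real e * \<delta>') * \<beta>" by (simp add: \<delta>(3))
  also have "\<dots> \<le> (1 / 2) * \<beta>" using e beta_pos by (intro mult_right_mono) (auto simp: \<delta>'_def)
  finally have e\<delta>: "real e * \<delta> \<le> \<beta> / 2" by simp
  have b: "\<beta> ^ 2 = 1 - \<beta>" "\<beta> ^ 3 = 2 * \<beta> - 1" "\<beta> ^ 4 = 2 - 3 * \<beta>" "\<beta> ^ 5 = 5 * \<beta> - 3" "\<beta> ^ 6 = 5 - 8 * \<beta>"
    using beta_square by (simp_all add: eval_nat_numeral algebra_simps) algebra+
  have err: "cf_err \<alpha> i = \<beta> ^ (i + 2)" for i
  proof (induction i)
    case 0 then show ?case using b(1) alpha_eq by (simp add: power2_eq_square)
  qed (simp add: cf_err_golden)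
  have err123: "cf_err \<alpha> 1 = 2 * \<beta> - 1" "cf_err \<alpha> 2 = 2 - 3 * \<beta>" "cf_err \<alpha> 3 = 5 * \<beta> - 3"
    using err[of 1] err[of 2] err[of 3] b by (simp_all add: power3_eq_cube)
  have q: "cf_q \<alpha> 2 = 3" "cf_q \<alpha> 3 = 5" "cf_q \<alpha> 4 = 8"
    using cf_q_golden by (simp_all add: eval_nat_numeral del: cf_q.simps(3))
  \<comment> \<open>For \<open>j = 1\<close> and \<open>j = 2\<close> the terms without
    \<open>e\<close> are too large for the factor 5/3, so the actual denominators 3, 5, 8 are
    used.\<close>
  consider "j = 1" | "j = 2" | "3 \<le> j" using assms(3) by linarith
  then have "\<delta> + \<delta>' + real N * \<delta> < 1"
  proof cases
    case 1
    have m4: "m = 4" using m q 1 by (simp add: eval_nat_numeral del: cf_q.simps)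
    have "e \<le> 2"
    proof (rule ccontr)
      assume "\<not> e \<le> 2"
      then have "3 * (2 * cf_err \<alpha> j) \<le> real e * (2 * cf_err \<alpha> j)"
        using cf_err_pos[of j] by (intro mult_right_mono) auto
      then have "3 * (2 * cf_err \<alpha> j) < 1" using e by linarith
      then show False using beta_bounds unfolding 1 err123 by (simp add: algebra_simps)
    qed
    then have "(e + 2) * m \<le> 4 * 4" unfolding m4 by (intro mult_right_mono) auto
    then have "N \<le> 4" using n N q 1 by (simp add: numeral_2_eq_2 del: cf_q.simps)
    then have "real N * \<delta> \<le> 4 * \<delta>" using \<delta> by (intro mult_right_mono) auto
    moreover have "\<delta> = 2 - 3 * \<beta>" "\<delta>' = 2 * \<beta> - 1"
      using err123 1 by (simp_all add: \<delta>_def \<delta>'_def numeral_2_eq_2)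
    ultimately show ?thesis using beta_bounds by linarith
  next
    case 2
    then have "m \<le> 7" using m q by (simp add: eval_nat_numeral del: cf_q.simps)
    then have "(e + 2) * m \<le> (e + 2) * 7" by (intro mult_left_mono) auto
    then have "N * 5 \<le> 7 * e + 12" using n N q 2 by (simp add: eval_nat_numeral del: cf_q.simps)
    then have "real N * 5 \<le> 7 * real e + 12" by linarith
    then have "(real N * 5) * \<delta> \<le> (7 * real e + 12) * \<delta>" using \<delta> by (intro mult_right_mono) auto
    then have "5 * (real N * \<delta>) \<le> 7 * (real e * \<delta>) + 12 * \<delta>" by (simp add: algebra_simps)
    moreover have "\<delta> = 5 * \<beta> - 3" "\<delta>' = 2 - 3 * \<beta>"
      using err123 2 by (simp_all add: \<delta>_def \<delta>'_def numeral_3_eq_3)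
    ultimately show ?thesis using e\<delta> beta_bounds by linarith
  next
    case 3
    obtain i where i: "j = Suc i" using 3 by (cases j) auto
    define Q where "Q = cf_q \<alpha> (Suc j)"
    have "3 * m \<le> 5 * Q" using m cf_q_ratio[of i] unfolding Q_def i by linarith
    have "3 * (N * Q) \<le> (e + 2) * (3 * m)" using n N by (simp add: Q_def algebra_simps)
    also have "\<dots> \<le> (e + 2) * (5 * Q)" using \<open>3 * m \<le> 5 * Q\<close> by (intro mult_left_mono) auto
    finally have "(3 * N) * Q \<le> (5 * (e + 2)) * Q" by (simp add: algebra_simps)
    then have "3 * N \<le> 5 * (e + 2)" using cf_q_pos[of "Suc j"] unfolding Q_def by simp
    then have "3 * N \<le> 5 * e + 10" by simp
    then have "3 * real N \<le> 5 * real e + 10" by linarith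
    then have "(3 * real N) * \<delta> \<le> (5 * real e + 10) * \<delta>" using \<delta> by (intro mult_right_mono) auto
    then have "3 * (real N * \<delta>) \<le> 5 * (real e * \<delta>) + 10 * \<delta>" by (simp add: algebra_simps)
    moreover have "\<delta> \<le> \<beta> ^ 6"
      unfolding \<delta>_def err using 3 beta_pos beta_less by (intro power_decreasing) auto
    moreover have "\<delta>' \<le> \<delta> * 2" unfolding \<delta>' using \<delta>(1) beta_less by (intro mult_left_mono) auto
    ultimately show ?thesis using e\<delta> beta_bounds b(5) by linarith
  qed
  then show ?thesis by (simp add: \<delta>_def \<delta>'_def)
qed

text \<open>It suffices to find a head length \<open>r < q\<close> that leaves a complete block and
  keeps all \<open>(n - r) div q\<close> drifts inside \<open>[0, 1)\<close>.\<close>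

lemma abelian_period_golden:
  assumes per: "abelian_period (slope_word \<alpha> x n) m"
    and m: "cf_q \<alpha> (Suc j) < m" "m < cf_q \<alpha> (Suc (Suc j))" and "1 \<le> j"
  shows "abelian_period (slope_word \<alpha> x n) (cf_q \<alpha> (Suc j))"
proof -
  define q where "q = cf_q \<alpha> (Suc j)"
  define d where "d = real q * \<alpha> - real (cf_p \<alpha> (Suc j))"
  have d_abs: "\<bar>d\<bar> = cf_err \<alpha> (Suc j)"
    using cf_q_cf_p_err[of "Suc j"] cf_err_pos[of "Suc j"] by (simp add: d_def q_def abs_mult del: cf_q.simps cf_p.simps)
  have d_le: "\<bar>d\<bar> \<le> \<alpha>" using d_abs cf_err_le[of "Suc j"] by simp
  obtain e c where e: "n + 2 \<le> (e + 2) * m" "m \<le> n" "real e * \<bar>real m * \<alpha> - of_int c\<bar> < 1"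
    by (rule abelian_period_slope_wordD[OF pos less_one per])
  have "real e * (2 * cf_err \<alpha> j) \<le> real e * \<bar>real m * \<alpha> - of_int c\<bar>"
    using second_best_approximation[OF m] by (intro mult_left_mono) auto
  then have e2: "real e * (2 * cf_err \<alpha> j) < 1" using e(3) by linarith
  have "cf_q \<alpha> 1 \<le> q" unfolding q_def by (rule cf_q_mono) simp
  then have q2: "2 \<le> q" using cf_q_golden(1) by simp
  have qm: "q < m" using m by (simp add: q_def)
  obtain r where r: "r < q" "r + q \<le> n"
    "0 \<le> frac (x + real r * \<alpha>) + real ((n - r) div q) * d"
    "frac (x + real r * \<alpha>) + real ((n - r) div q) * d < 1"
  \<comment> \<open>In a short word a late start may leave no complete block. The starts 0 and 1
    leave exactly one, because \<open>q < m \<le> n\<close>.\<close>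
  proof (cases "n < 2 * q")
    case True
    have div1: "(n - r) div q = 1" if "r \<le> 1" for r
      using that True qm e(2) by (intro div_nat_eqI) auto
    define g where "g = frac x"
    have g: "0 \<le> g" "g < 1" "x = of_int \<lfloor>x\<rfloor> + g"
      unfolding g_def by (rule frac_ge_0, rule frac_lt_1) (simp add: frac_def)
    show ?thesis
    proof (cases "0 \<le> g + d \<and> g + d < 1")
      case True
      then show ?thesis using that[of 0] div1[of 0] q2 qm e(2) by (simp add: g_def)
    next
      case False
      \<comment> \<open>If start 0 fails, \<open>frac x\<close> is within
        \<open>\<bar>d\<bar> \<le> \<alpha>\<close> of the end it drifts to. One rotation step
        clears that end, and \<open>2 * \<alpha> < 1\<close> keeps the other end out of
        reach.\<close>
      have "0 \<le> frac (x + \<alpha>) + d \<and> frac (x + \<alpha>) + d < 1"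
      proof (cases "0 \<le> d")
        case True
        then have "frac (x + \<alpha>) = g + \<alpha> - 1"
          using False g(1,2) d_le less_half pos by (intro frac_eqI[of _ "\<lfloor>x\<rfloor> + 1"]) (auto simp: g(3)[symmetric])
        then show ?thesis using True False g d_le less_half pos by linarith
      next
        case d: False
        then have "frac (x + \<alpha>) = g + \<alpha>"
          using False g(1,2) d_le less_half pos by (intro frac_eqI[of _ "\<lfloor>x\<rfloor>"]) (auto simp: g(3)[symmetric])
        then show ?thesis using d False g d_le less_half pos by linarith
      qed
      then show ?thesis using that[of 1] div1[of 1] q2 qm e(2) by simp
    qed
  next
    case False
    obtain r0 where r0: "r0 < q"
      "0 \<le> frac (x + real r0 * \<alpha>) + real (n div q) * d"
      "frac (x + real r0 * \<alpha>) + real (n div q) * d < 1"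
      unfolding q_def
    proof (rule rotation_start)
      show "cf_err \<alpha> (Suc j) + cf_err \<alpha> j + real (n div cf_q \<alpha> (Suc j)) * cf_err \<alpha> (Suc j) < 1"
        using m assms(4) e2 e(1) by (rule covered_blocks) simp
    qed (auto simp: d_def q_def)
    \<comment> \<open>The count \<open>n div q\<close> served as a bound independent of
      \<open>r0\<close>. The actual count is no larger, so its drift stays in range.\<close>
    define N where "N = (n - r0) div q"
    have N: "real N \<le> real (n div q)" by (simp add: N_def div_le_mono)
    have f01: "0 \<le> frac (x + real r0 * \<alpha>)" "frac (x + real r0 * \<alpha>) < 1" by (auto simp: frac_lt_1)
    have "0 \<le> frac (x + real r0 * \<alpha>) + real N * d \<and> frac (x + real r0 * \<alpha>) + real N * d < 1"
    proof (cases "0 \<le> d")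
      case True
      then have "real N * d \<le> real (n div q) * d" "0 \<le> real N * d"
        using N by (auto intro: mult_right_mono)
      then show ?thesis using r0 f01 by linarith
    next
      case d: False
      then have "real (n div q) * d \<le> real N * d" "real N * d \<le> 0"
        using N by (auto intro: mult_right_mono_neg simp: mult_nonneg_nonpos)
      then show ?thesis using r0 f01 by linarith
    qed
    then show ?thesis using that[of r0] r0(1) False by (simp add: N_def)
  qed
  define N where "N = (n - r) div q"
  have "0 < N" using r q2 by (simp add: N_def div_greater_zero_iff)
  moreover have "N * q \<le> n - r" "n - r < q + N * q"
    unfolding N_def using q2 by (simp_all add: dividend_less_div_times)
  then have "r + N * q \<le> n" "n < r + (N + 1) * q" using r(2) by auto
  ultimately show ?thesis
    unfolding q_def[symmetric] using r(1,3,4)[folded N_def]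
    by (intro abelian_period_of_approximation[OF pos less_half d_def d_le, where N = N and r = r]) auto
qed

text \<open>A minimum strictly between consecutive denominators would make the smaller denominator a
  period too. The initial denominators 1, 2, 3 leave no gap, which supplies
  \<open>1 \<le> j\<close>.\<close>

lemma min_abelian_period_golden:
  assumes "w \<in> slope_factors \<alpha>" "w \<noteq> []"
  shows "min_abelian_period w \<in> {cf_q \<alpha> k | k. k \<ge> 0}"
proof (rule ccontr)
  assume no: "min_abelian_period w \<notin> {cf_q \<alpha> k | k. k \<ge> 0}"
  obtain x where w: "w = slope_word \<alpha> x (length w)"
    using slope_factorsD[OF pos less_one assms(1)] by blast
  define m where "m = min_abelian_period w"
  have "abelian_period w (length w)"
    using abelian_period_length_slope_word[OF pos less_one, of "length w" x] w assms(2) by simp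
  then have per: "abelian_period w m" unfolding m_def min_abelian_period_def by (rule LeastI)
  have "0 < m"
    using per w by (metis abelian_period_slope_wordD[OF pos less_one])
  have grow: "k < cf_q \<alpha> k" for k
    by (induction k) (use cf_q_pos[of 0] cf_q_less in \<open>auto intro: le_less_trans[OF Suc_leI]\<close>)
  define k where "k = (LEAST k. m < cf_q \<alpha> k)"
  have "m < cf_q \<alpha> k" unfolding k_def using grow[of m] by (rule LeastI)
  moreover have "k \<noteq> 0" using \<open>m < cf_q \<alpha> k\<close> \<open>0 < m\<close> by (cases k) auto
  then obtain i where i: "k = Suc i" by (cases k) auto
  have "\<not> m < cf_q \<alpha> i" using not_less_Least[of i "\<lambda>k. m < cf_q \<alpha> k"] i by (simp add: k_def)
  moreover have ne: "m \<noteq> cf_q \<alpha> i" for i using no by (auto simp: m_def)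
  ultimately have mi: "cf_q \<alpha> i < m" "m < cf_q \<alpha> (Suc i)" using i by (metis linorder_neqE_nat, simp)
  have "cf_q \<alpha> 0 = 1" "cf_q \<alpha> (Suc 0) = 2" "cf_q \<alpha> (Suc (Suc 0)) = 3"
    using cf_q_golden by (simp_all del: cf_q.simps(2,3))
  then have "i \<noteq> 0 \<and> i \<noteq> Suc 0" using mi by (intro conjI notI) (simp_all del: cf_q.simps)
  then obtain j where j: "i = Suc j" "1 \<le> j" by (cases i) auto
  have "abelian_period w (cf_q \<alpha> i)"
    using abelian_period_golden[of x "length w" m j] per mi j w by simp
  then show False using not_less_Least[of "cf_q \<alpha> i" "abelian_period w"] mi
    by (simp add: m_def min_abelian_period_def)
qed

end

section \<open>Both directions of the equivalence\<close>

theorem theorem5p9: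
  fixes \<alpha> :: real
  assumes "\<alpha> \<notin> \<rat>" and "0 < \<alpha>" and "\<alpha> < 1 / 2"
  shows "\<alpha> = 1 / ((1 + sqrt 5) / 2) ^ 2 \<longleftrightarrow>
         (\<forall>w \<in> slope_factors \<alpha>. w \<noteq> [] \<longrightarrow>
            min_abelian_period w \<in> {cf_q \<alpha> k | k. k \<ge> 0})"
proof -
  interpret irrational_slope \<alpha> using assms by unfold_locales
  show ?thesis
  proof
    assume golden: "\<alpha> = 1 / ((1 + sqrt 5) / 2) ^ 2"
    define \<beta> :: real where "\<beta> = (sqrt 5 - 1) / 2"
    have "1 < sqrt (5 :: real)" "sqrt (5 :: real) < 3" by (simp, rule real_less_lsqrt) auto
    then have \<beta>01: "0 < \<beta>" "\<beta> < 1" by (auto simp: \<beta>_def)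
    have \<beta>2: "\<beta> * \<beta> = 1 - \<beta>" by (simp add: \<beta>_def field_simps)
    have "((1 + sqrt 5) / 2) ^ 2 = 2 + \<beta>" by (simp add: \<beta>_def power2_eq_square field_simps)
    moreover have "(1 - \<beta>) * (2 + \<beta>) = 1" using \<beta>2 by (simp add: algebra_simps)
    then have "1 / (2 + \<beta>) = 1 - \<beta>" using \<beta>01 by (simp add: divide_eq_eq)
    ultimately have "\<alpha> = 1 - \<beta>" using golden by simp
    then interpret golden_slope \<alpha> \<beta> using \<beta>2 \<beta>01 by unfold_locales
    show "\<forall>w \<in> slope_factors \<alpha>. w \<noteq> [] \<longrightarrow> min_abelian_period w \<in> {cf_q \<alpha> k | k. k \<ge> 0}"
      using min_abelian_period_golden by blast
  next
    assume all: "\<forall>w \<in> slope_factors \<alpha>. w \<noteq> [] \<longrightarrow> min_abelian_period w \<in> {cf_q \<alpha> k | k. k \<ge> 0}"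
    \<comment> \<open>Excluding both kinds of counterexample leaves only the partial quotients 2, 1,
      1, ...\<close>
    then have "\<not> 3 \<le> cf_a \<alpha> (Suc 0)" using first_quotient_counterexample by blast
    then have "cf_a \<alpha> (Suc 0) = 2" using cf_a_1 by simp
    moreover have "cf_a \<alpha> (Suc (Suc i)) = 1" for i
    proof -
      have "\<not> 2 \<le> cf_a \<alpha> (Suc (Suc i))" using all later_quotient_counterexample by blast
      then show ?thesis using cf_a_pos[of "Suc i"] by simp
    qed
    ultimately show "\<alpha> = 1 / ((1 + sqrt 5) / 2) ^ 2" by (rule golden_of_quotients)
  qed
qed

end
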